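(* Let $v(0)\in\mathcal N^*$ with $v_1(0)>0$, and let $v(t)$ be the solution of the critical equations with initial condition $v(0)$. Then for every $k\ge1$ $$\lim_{t\to\infty}t\,v_k(t)=\frac{k^{k-1}}{k!}e^{-k}\qquad\text{and}\qquad\lim_{t\to\infty}t\,m_0(t)=1.$$
   Context: $\mathcal N$: sequences $v=(v_k)_{k\ge1}$ of nonnegative reals with $\sum_kv_k<\infty$; $\mathcal N^*$: those with finitely many nonzero terms; $m_0=\sum_kv_k$. Critical equations: $v(t)\in\mathcal N$ with $v_k(t)=v_k(0)+\int_0^t\big(\tfrac k2\sum_{l=1}^{k-1}v_l(s)v_{k-l}(s)-kv_k(s)m_0(s)\big)ds$ for all $k\ge1$, with $\Phi(t)=m_0(0)-m_0(t)$ nondecreasing with values in $[0,m_0(0))$; the solution is unique. *)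

theory Defs
  imports "HOL-Analysis.Analysis"
begin

text \<open>A sequence (v_k)_{k>=1} is represented as a function nat => real; index 0 is ignored.
  A time-dependent sequence is v :: real => nat => real, with v t k = v_k(t).\<close>

definition in_N :: "(nat \<Rightarrow> real) \<Rightarrow> bool" where
  "in_N w \<longleftrightarrow> (\<forall>k\<ge>1. 0 \<le> w k) \<and> summable (\<lambda>k. w (Suc k))"

definition in_N_star :: "(nat \<Rightarrow> real) \<Rightarrow> bool" where
  "in_N_star w \<longleftrightarrow> in_N w \<and> finite {k. 1 \<le> k \<and> w k \<noteq> 0}"

definition mass0 :: "(nat \<Rightarrow> real) \<Rightarrow> real" where
  "mass0 w = (\<Sum>k. w (Suc k))"

definition critical_solution :: "(real \<Rightarrow> nat \<Rightarrow> real) \<Rightarrow> bool" where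
  "critical_solution v \<longleftrightarrow>
     (\<forall>t\<ge>0. in_N (v t)) \<and>
     (\<forall>t\<ge>0. \<forall>k\<ge>1.
        ((\<lambda>s. real k / 2 * (\<Sum>l=1..k-1. v s l * v s (k - l)) - real k * v s k * mass0 (v s))
          has_integral (v t k - v 0 k)) {0..t}) \<and>
     mono_on {0..} (\<lambda>t. mass0 (v 0) - mass0 (v t)) \<and>
     (\<forall>t\<ge>0. 0 \<le> mass0 (v 0) - mass0 (v t) \<and> mass0 (v 0) - mass0 (v t) < mass0 (v 0))"

end

theory Submission
  imports Defs
begin

text \<open>Put \<open>M t = \<integral>\<^sub>0\<^sup>t m\<^sub>0\<close>. The functions \<open>w\<^sub>k = v\<^sub>k exp (k M)\<close> solve
  \<open>w\<^sub>k' = k/2 (\<Sum>l. w\<^sub>l w\<^sub>k\<^sub>-\<^sub>l)\<close>, so \<open>w\<^sub>k\<close> is a polynomial in \<open>t\<close> whose leading term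
  \<open>v\<^sub>1(0)^k k^(k-1)/k! t^(k-1)\<close> comes from Abel's identity, and everything reduces to
  \<open>M t - ln t \<longlongrightarrow> 1 + ln v\<^sub>1(0)\<close>; the claim on \<open>m\<^sub>0\<close> then follows by monotonicity.
  The generating function \<open>G\<close> of \<open>v\<close> is constant along characteristics: for \<open>z < 1\<close> and \<open>u = G(T, z)\<close>,
  \<open>u = G(0, \<xi>)\<close> with \<open>\<xi> = z exp (T u - M T)\<close>. Monotonicity of \<open>\<xi>\<close> in \<open>z\<close> forces \<open>t m\<^sub>0(t) \<le> 1\<close>, so
  \<open>M - ln\<close> is nonincreasing; \<open>u \<ge> v\<^sub>1(0) \<xi>\<close> bounds it below by \<open>1 + ln v\<^sub>1(0)\<close>; and since
  \<open>\<xi>\<close> tends to 0, \<open>u\<close> is asymptotically at most \<open>v\<^sub>1(0) \<xi>\<close>, which excludes any larger limit.\<close>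

section \<open>Abel's identity and the coefficients of the tree function\<close>

text \<open>Pascal's rule turns the sum for \<open>Suc n\<close> into
  \<open>S j x - S j (x + 1)\<close>. For \<open>j < n\<close> both terms vanish by induction; for
  \<open>j = n\<close> the derivative \<open>n * S (n - 1)\<close> vanishes, so \<open>S n\<close>
  is constant.\<close>

lemma alternating_binomial_power_sum_eq_0:
  fixes x :: real
  assumes "j < n"
  shows "(\<Sum>i\<le>n. (-1) ^ i * real (n choose i) * (x + real i) ^ j) = 0"
  using assms
proof (induction n arbitrary: j x)
  case 0
  then show ?case by simp
next
  case (Suc n)
  define S where "S j y = (\<Sum>i\<le>n. (-1) ^ i * real (n choose i) * (y + real i) ^ j)" for j and y :: real
  have "(\<Sum>i\<le>Suc n. (-1) ^ i * real (Suc n choose i) * (x + real i) ^ j)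
      = x ^ j + (\<Sum>i\<le>n. (-1) ^ Suc i * real (n choose Suc i) * (x + real (Suc i)) ^ j)
        + (\<Sum>i\<le>n. (-1) ^ Suc i * real (n choose i) * (x + real (Suc i)) ^ j)"
    by (simp only: sum.atMost_Suc_shift sum.distrib[symmetric] binomial_Suc_Suc)
       (simp add: algebra_simps sum.distrib sum_subtractf sum_negf)
  also have "x ^ j + (\<Sum>i\<le>n. (-1) ^ Suc i * real (n choose Suc i) * (x + real (Suc i)) ^ j)
      = (\<Sum>i\<le>Suc n. (-1) ^ i * real (n choose i) * (x + real i) ^ j)"
    by (simp only: sum.atMost_Suc_shift) simp
  also have "\<dots> = S j x"
    by (simp add: S_def)
  also have "(\<Sum>i\<le>n. (-1) ^ Suc i * real (n choose i) * (x + real (Suc i)) ^ j) = - S j (x + 1)"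
    by (simp add: S_def sum_negf add_ac)
  finally have pascal: "(\<Sum>i\<le>Suc n. (-1) ^ i * real (Suc n choose i) * (x + real i) ^ j)
      = S j x - S j (x + 1)" by simp
  have "S j x = S j (x + 1)"
  proof (cases "j < n")
    case True
    then show ?thesis using Suc.IH by (simp add: S_def)
  next
    case False
    then have [simp]: "j = n" using Suc.prems by simp
    have deriv: "(S n has_real_derivative real n * S (n - 1) y) (at y)" for y
      unfolding S_def
      by (auto intro!: derivative_eq_intros simp: sum_distrib_left mult_ac)
    have zero: "real n * S (n - 1) y = 0" for y
      using Suc.IH[of "n - 1" y] by (cases "n = 0") (auto simp: S_def)
    have "\<forall>y. DERIV (S n) y :> 0" using deriv unfolding zero by blast
    then have "S n x = S n (x + 1)" by (rule DERIV_isconst_all)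
    then show ?thesis by simp
  qed
  with pascal show ?case by simp
qed

text \<open>This is Abel's identity
  \<open>(\<Sum>l\<le>n. (n choose l) x (x + l) ^ (l - 1) (y + n - l) ^ (n - l)) = (x + y + n) ^ n\<close>,
  differentiated in \<open>x\<close> at \<open>x = 0\<close>. Both sides have the same derivative in \<open>y\<close> by induction,
  and vanish at \<open>y = - n\<close> since finite differences of order \<open>n\<close> annihilate \<open>l ^ (n - 1)\<close>.\<close>

lemma Abel_identity_limit:
  fixes y :: real
  assumes "n \<ge> 1"
  shows "(\<Sum>l=1..n. real (n choose l) * real l ^ (l - 1) * (y + real (n - l)) ^ (n - l))
           = real n * (y + real n) ^ (n - 1)"
  using assms
proof (induction n arbitrary: y rule: dec_induct)
  case base
  then show ?case by simp
next
  case (step n)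
  define Q where "Q y = (\<Sum>l=1..Suc n. real (Suc n choose l) * real l ^ (l - 1) * (y + real (Suc n - l)) ^ (Suc n - l))
     - real (Suc n) * (y + real (Suc n)) ^ n" for y :: real
  have "(Q has_real_derivative 0) (at y)" for y
  proof -
    have "(Q has_real_derivative
        (\<Sum>l=1..Suc n. real (Suc n choose l) * real l ^ (l - 1) * (real (Suc n - l) * (y + real (Suc n - l)) ^ (Suc n - l - 1)))
         - real (Suc n) * (real n * (y + real (Suc n)) ^ (n - 1))) (at y)"
      unfolding Q_def by (auto intro!: derivative_eq_intros sum.cong simp: mult_ac)
    also have "(\<Sum>l=1..Suc n. real (Suc n choose l) * real l ^ (l - 1) * (real (Suc n - l) * (y + real (Suc n - l)) ^ (Suc n - l - 1)))
       = (\<Sum>l=1..n. real (Suc n choose l) * real l ^ (l - 1) * (real (Suc n - l) * (y + real (Suc n - l)) ^ (Suc n - l - 1)))"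
      by simp
    also have "\<dots> = (\<Sum>l=1..n. real (Suc n) * (real (n choose l) * real l ^ (l - 1) * ((y + 1) + real (n - l)) ^ (n - l)))"
    proof (rule sum.cong)
      fix l assume l: "l \<in> {1..n}"
      have "(Suc n choose l) * (Suc n - l) = Suc n * (n choose l)"
        using binomial_absorb_comp[of "Suc n" l] by (simp add: mult.commute)
      then have e: "real (Suc n choose l) * real (Suc n - l) = real (Suc n) * real (n choose l)"
        by (metis of_nat_mult)
      have "y + real (Suc n - l) = (y + 1) + real (n - l)" "Suc n - l - 1 = n - l"
        using l by (auto simp: of_nat_diff)
      then have "real (Suc n choose l) * real l ^ (l - 1) * (real (Suc n - l) * (y + real (Suc n - l)) ^ (Suc n - l - 1))
         = (real (Suc n choose l) * real (Suc n - l)) * (real l ^ (l - 1) * ((y + 1) + real (n - l)) ^ (n - l))"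
        by (simp only: mult_ac)
      then show "real (Suc n choose l) * real l ^ (l - 1) * (real (Suc n - l) * (y + real (Suc n - l)) ^ (Suc n - l - 1))
         = real (Suc n) * (real (n choose l) * real l ^ (l - 1) * ((y + 1) + real (n - l)) ^ (n - l))"
        by (simp only: e mult.assoc)
    qed simp
    also have "\<dots> = real (Suc n) * (real n * ((y + 1) + real n) ^ (n - 1))"
      by (simp only: sum_distrib_left[symmetric] step.IH)
    finally show ?thesis by (simp add: add_ac)
  qed
  then have "\<forall>y. DERIV Q y :> 0" by simp
  \<comment> \<open>At this point the closed form vanishes and \<open>y + real (Suc n - l)\<close>
    is \<open>- l\<close>, so the two powers merge into \<open>l ^ n\<close>.\<close>
  then have "Q y = Q (- real (Suc n))" by (rule DERIV_isconst_all)
  also have "\<dots> = (\<Sum>l=1..Suc n. (-1) ^ Suc n * ((-1) ^ l * real (Suc n choose l) * (0 + real l) ^ n))"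
  proof -
    have "real (Suc n choose l) * real l ^ (l - 1) * (- real (Suc n) + real (Suc n - l)) ^ (Suc n - l)
       = (-1) ^ Suc n * ((-1) ^ l * real (Suc n choose l) * (0 + real l) ^ n)" if l: "l \<in> {1..Suc n}" for l
    proof -
      have "- real (Suc n) + real (Suc n - l) = (-1) * real l" using l by (simp add: of_nat_diff)
      moreover have "real l ^ n = real l ^ (l - 1) * real l ^ (Suc n - l)"
        using l by (simp add: power_add[symmetric])
      moreover have "(-1::real) ^ (Suc n - l) = (-1) ^ Suc n * (-1) ^ l"
        using l by (auto simp: minus_one_power_iff even_diff_nat)
      ultimately show ?thesis by (simp only: power_mult_distrib add_0_left mult_ac)
    qed
    then show ?thesis using step.hyps unfolding Q_def by simp
  qed
  \<comment> \<open>The added term \<open>l = 0\<close> is zero because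
    \<open>n \<ge> 1\<close>.\<close>
  also have "\<dots> = (-1) ^ Suc n * (\<Sum>l\<le>Suc n. (-1) ^ l * real (Suc n choose l) * (0 + real l) ^ n)"
    unfolding sum_distrib_left[symmetric] using step.hyps
    by (intro arg_cong[where f = "(*) _"] sum.mono_neutral_left) (auto simp: not_less_eq_eq)
  also have "\<dots> = 0"
    by (simp only: alternating_binomial_power_sum_eq_0[OF lessI] mult_zero_right)
  finally show ?case by (simp add: Q_def)
qed

text \<open>Abel's identity at \<open>y = 0\<close> evaluates the sum with the extra weight
  \<open>n - l\<close>. The summand is symmetric under \<open>l -> n - l\<close>, so the weights
  \<open>n - l\<close> and \<open>l\<close> give equal sums, each \<open>n / 2\<close> times the
  wanted one.\<close>

lemma sum_binomial_tree_numbers: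
  assumes "n \<ge> 2"
  shows "(\<Sum>l=1..n-1. real (n choose l) * real l ^ (l - 1) * real (n - l) ^ (n - l - 1))
           = 2 * real (n - 1) * real n ^ (n - 2)"
proof -
  define f where "f l = real (n choose l) * real l ^ (l - 1) * real (n - l) ^ (n - l - 1)" for l
  \<comment> \<open>The term \<open>l = n\<close> is split off; it equals \<open>n ^ (n - 1)\<close>
    because \<open>0 ^ 0 = 1\<close>.\<close>
  have "{1..n} = insert n {1..n-1}" using assms by auto
  then have "(\<Sum>l=1..n-1. real (n choose l) * real l ^ (l - 1) * real (n - l) ^ (n - l)) + real n ^ (n - 1)
      = real n * real n ^ (n - 1)"
    using Abel_identity_limit[of n 0] assms by simp
  moreover have "(\<Sum>l=1..n-1. real (n choose l) * real l ^ (l - 1) * real (n - l) ^ (n - l))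
      = (\<Sum>l=1..n-1. real (n - l) * f l)"
    unfolding f_def
  proof (rule sum.cong)
    fix l assume "l \<in> {1..n-1}"
    then have "real (n - l) ^ (n - l) = real (n - l) * real (n - l) ^ (n - l - 1)"
      by (cases "n - l") auto
    then show "real (n choose l) * real l ^ (l - 1) * real (n - l) ^ (n - l) =
        real (n - l) * (real (n choose l) * real l ^ (l - 1) * real (n - l) ^ (n - l - 1))" by simp
  qed simp
  moreover have "(\<Sum>l=1..n-1. real (n - l) * f l) = (\<Sum>l=1..n-1. real l * f l)"
  proof (rule sum.reindex_bij_witness[of _ "\<lambda>l. n - l" "\<lambda>l. n - l"])
    fix l assume l: "l \<in> {1..n-1}"
    then have "n - (n - l) = l" "n choose (n - l) = n choose l"
      using binomial_symmetric[of l n] by auto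
    then have "f (n - l) = f l"
      unfolding f_def by (simp only: mult_ac)
    with l show "real (n - l) * f (n - l) = real (n - l) * f l" by simp
  qed (use assms in auto)
  moreover have "(\<Sum>l=1..n-1. real (n - l) * f l) + (\<Sum>l=1..n-1. real l * f l) = real n * (\<Sum>l=1..n-1. f l)"
    unfolding sum_distrib_left sum.distrib[symmetric]
    by (rule sum.cong) (auto simp: of_nat_diff algebra_simps)
  ultimately have "real n * (\<Sum>l=1..n-1. f l) = 2 * (real n - 1) * real n ^ (n - 1)"
    by (simp add: algebra_simps)
  also have "real n ^ (n - 1) = real n * real n ^ (n - 2)"
    using assms by (simp add: power_Suc[symmetric] del: power_Suc)
  finally have "(\<Sum>l=1..n-1. f l) = 2 * (real n - 1) * real n ^ (n - 2)"
    using assms by simp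
  then show ?thesis using assms by (simp add: f_def of_nat_diff)
qed

text \<open>This is the coefficient form of \<open>x T' = T + x T T'\<close> for the tree function
  \<open>T x = (\<Sum>k. k ^ (k - 1) / k! x ^ k)\<close>, which satisfies \<open>T e\<^sup>-\<^sup>T = x\<close>.\<close>

lemma tree_coefficients_recursion:
  assumes "k \<ge> 2"
  shows "real k / 2 * (\<Sum>l=1..k-1. (real l ^ (l - 1) / fact l) * (real (k - l) ^ (k - l - 1) / fact (k - l)))
           = real (k - 1) * (real k ^ (k - 1) / fact k)"
proof -
  have *: "(real l ^ (l - 1) / fact l) * (real (k - l) ^ (k - l - 1) / fact (k - l))
      = (real (k choose l) * real l ^ (l - 1) * real (k - l) ^ (k - l - 1)) / fact k"
    if "l \<in> {1..k-1}" for l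
  proof -
    have "l \<le> k" using that by auto
    then show ?thesis by (simp add: binomial_fact)
  qed
  have "(\<Sum>l=1..k-1. (real l ^ (l - 1) / fact l) * (real (k - l) ^ (k - l - 1) / fact (k - l)))
      = (\<Sum>l=1..k-1. (real (k choose l) * real l ^ (l - 1) * real (k - l) ^ (k - l - 1)) / fact k)"
    by (rule sum.cong[OF refl *])
  also have "\<dots> = (2 * real (k - 1) * real k ^ (k - 2)) / fact k"
    unfolding sum_divide_distrib[symmetric] sum_binomial_tree_numbers[OF assms] ..
  finally have "(\<Sum>l=1..k-1. (real l ^ (l - 1) / fact l) * (real (k - l) ^ (k - l - 1) / fact (k - l)))
      = (2 * real (k - 1) * real k ^ (k - 2)) / fact k" .
  then have "real k / 2 * (\<Sum>l=1..k-1. (real l ^ (l - 1) / fact l) * (real (k - l) ^ (k - l - 1) / fact (k - l)))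
      = real (k - 1) * (real k * real k ^ (k - 2) / fact k)"
    by simp
  also have "real k * real k ^ (k - 2) = real k ^ (k - 1)"
    using assms by (simp add: power_Suc[symmetric] del: power_Suc)
  finally show ?thesis .
qed

section \<open>Differential equations\<close>

text \<open>Where \<open>f\<close> vanishes, the difference quotient of the product is that of
  \<open>f\<close> times \<open>g y\<close>, so \<open>g\<close> only has to be continuous.\<close>

lemma has_real_derivative_mult_zero_left:
  fixes f g :: "real \<Rightarrow> real"
  assumes f: "(f has_real_derivative d) (at x within S)" "f x = 0"
    and g: "continuous (at x within S) g"
  shows "((\<lambda>y. f y * g y) has_real_derivative d * g x) (at x within S)"
proof -
  have "((\<lambda>y. (f y - f x) / (y - x) * g y) \<longlongrightarrow> d * g x) (at x within S)"
    using f(1) g unfolding has_field_derivative_iff continuous_within by (rule tendsto_mult)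
  then show ?thesis
    using f(2) by (simp add: has_field_derivative_iff)
qed

text \<open>The increment of \<open>p\<close> is of smaller order than \<open>f y - f x\<close>,
  hence than \<open>y - x\<close>; \<open>f\<close> itself may fail to be differentiable.\<close>

lemma has_real_derivative_zero_compose_lipschitz:
  fixes p f :: "real \<Rightarrow> real"
  assumes p: "(p has_real_derivative 0) (at (f x))"
    and f: "\<And>y. y \<in> S \<Longrightarrow> \<bar>f y - f x\<bar> \<le> C * \<bar>y - x\<bar>" and "0 \<le> C"
  shows "((\<lambda>y. p (f y)) has_real_derivative 0) (at x within S)"
  unfolding has_field_derivative_def has_derivative_within_alt
proof safe
  show "bounded_linear ((*) (0::real))" by (rule bounded_linear_mult_right)
  fix e :: real assume "e > 0"
  then have "e / (C + 1) > 0" using \<open>0 \<le> C\<close> by simp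
  then have "\<exists>d>0. \<forall>y\<in>UNIV. norm (y - f x) < d \<longrightarrow> norm (p y - p (f x) - 0 * (y - f x)) \<le> e / (C + 1) * norm (y - f x)"
    using p unfolding has_field_derivative_def has_derivative_within_alt by blast
  then obtain d where d: "d > 0" "\<And>y. \<bar>y - f x\<bar> < d \<Longrightarrow> \<bar>p y - p (f x)\<bar> \<le> e / (C + 1) * \<bar>y - f x\<bar>"
    by auto
  show "\<exists>d>0. \<forall>y\<in>S. norm (y - x) < d \<longrightarrow> norm (p (f y) - p (f x) - 0 * (y - x)) \<le> e * norm (y - x)"
  proof (intro exI conjI ballI impI)
    show "d / (C + 1) > 0" using d \<open>0 \<le> C\<close> by simp
    fix y assume y: "y \<in> S" "norm (y - x) < d / (C + 1)"
    have b: "\<bar>f y - f x\<bar> \<le> (C + 1) * \<bar>y - x\<bar>"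
      using f[OF y(1)] by (simp add: algebra_simps)
    moreover have "(C + 1) * \<bar>y - x\<bar> < d"
      using y(2) \<open>0 \<le> C\<close> by (simp add: field_simps)
    ultimately have "\<bar>p (f y) - p (f x)\<bar> \<le> e / (C + 1) * \<bar>f y - f x\<bar>"
      by (intro d(2)) simp
    also have "\<dots> \<le> e / (C + 1) * ((C + 1) * \<bar>y - x\<bar>)"
      using b \<open>e / (C + 1) > 0\<close> by (intro mult_left_mono) auto
    also have "\<dots> = e * \<bar>y - x\<bar>" using \<open>0 \<le> C\<close> by simp
    finally show "norm (p (f y) - p (f x) - 0 * (y - x)) \<le> e * norm (y - x)" by simp
  qed
qed

text \<open>As \<open>m\<close> may be discontinuous, the product rule is not available at every point.
  Freezing \<open>f\<close> at \<open>t\<close>, the function \<open>A = f + c f(t) M\<close> has a derivative at \<open>t\<close>, and the remaining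
  factor depends smoothly on \<open>M\<close> with vanishing derivative.\<close>

lemma has_real_derivative_integrating_factor:
  fixes f F m :: "real \<Rightarrow> real" and c T :: real
  defines "M \<equiv> \<lambda>t. integral {0..t} m"
  assumes F: "continuous_on {0..T} F"
    and m: "m integrable_on {0..T}" "\<And>s. s \<in> {0..T} \<Longrightarrow> \<bar>m s\<bar> \<le> K"
    and f: "\<And>t. t \<in> {0..T} \<Longrightarrow> ((\<lambda>s. F s - c * f s * m s) has_integral (f t - f 0)) {0..t}"
    and t: "t \<in> {0..T}"
  shows "((\<lambda>s. f s * exp (c * M s)) has_real_derivative F t * exp (c * M t)) (at t within {0..T})"
proof -
  let ?I = "{0..T}"
  have "T \<in> ?I" "0 \<le> K" using t m(2)[of 0] by auto
  have M: "continuous_on ?I M"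
    unfolding M_def by (rule indefinite_integral_continuous_1[OF m(1)])
  have int: "(\<lambda>s. F s - c * f s * m s) integrable_on ?I"
    using f[OF \<open>T \<in> ?I\<close>] by blast
  have "continuous_on ?I (\<lambda>s. f 0 + integral {0..s} (\<lambda>s. F s - c * f s * m s))"
    by (intro continuous_intros indefinite_integral_continuous_1[OF int])
  moreover have "f 0 + integral {0..s} (\<lambda>s. F s - c * f s * m s) = f s" if "s \<in> ?I" for s
    using integral_unique[OF f[OF that]] by simp
  ultimately have contf: "continuous_on ?I f"
    by (rule continuous_on_eq)
  have lip: "\<bar>M s - M t\<bar> \<le> K * \<bar>s - t\<bar>" if s: "s \<in> ?I" for s
  proof -
    have *: "\<bar>M b - M a\<bar> \<le> K * (b - a)" if ab: "a \<in> ?I" "b \<in> ?I" "a \<le> b" for a b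
    proof -
      have mi: "m integrable_on {0..b}" "m integrable_on {a..b}"
        using ab by (auto intro: integrable_subinterval_real[OF m(1)])
      have "M b - M a = integral {a..b} m"
        using Henstock_Kurzweil_Integration.integral_combine[of 0 a b m] ab mi by (simp add: M_def)
      moreover have "norm (integral {a..b} m) \<le> integral {a..b} (\<lambda>_. K)"
        by (rule integral_norm_bound_integral) (use ab mi m(2) in auto)
      ultimately show ?thesis using ab by (simp add: mult.commute)
    qed
    show ?thesis using *[of s t] *[of t s] s t by (cases "s \<le> t") auto
  qed
  define A where "A s = f s + c * f t * M s" for s
  \<comment> \<open>In \<open>g\<close> the possibly discontinuous \<open>m\<close> only occurs
    times \<open>f s - f t\<close>, so \<open>g\<close> is continuous at \<open>t\<close> and its
    integral is differentiable there.\<close>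
  define g where "g s = F s - c * m s * (f s - f t)" for s
  have g_eq: "g = (\<lambda>s. (F s - c * f s * m s) + (c * f t) * m s)"
    by (simp add: g_def fun_eq_iff algebra_simps)
  have g_int: "g integrable_on ?I"
    unfolding g_eq by (intro integrable_add int integrable_on_mult_right m(1))
  have A_eq: "A s = f 0 + integral {0..s} g" if s: "s \<in> ?I" for s
  proof -
    have "m integrable_on {0..s}" using s by (auto intro: integrable_subinterval_real[OF m(1)])
    then have "((\<lambda>x. (c * f t) * m x) has_integral (c * f t) * M s) {0..s}"
      unfolding M_def by (intro has_integral_mult_right integrable_integral)
    from has_integral_add[OF f[OF s] this] show ?thesis
      by (simp add: g_eq A_def integral_unique)
  qed
  have tend: "(g \<longlongrightarrow> F t) (at t within ?I)"
  proof -
    have "((\<lambda>s. f s - f t) \<longlongrightarrow> 0) (at t within ?I)"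
      using contf t by (auto simp: continuous_on_def LIM_zero_iff)
    moreover have "\<forall>\<^sub>F s in at t within ?I. norm (c * m s) \<le> \<bar>c\<bar> * K"
      using m(2) by (auto simp: eventually_at_filter abs_mult intro!: always_eventually mult_left_mono)
    ultimately have "((\<lambda>s. c * m s * (f s - f t)) \<longlongrightarrow> 0) (at t within ?I)"
      by (intro lim_null_mult_left_bounded)
    moreover have "(F \<longlongrightarrow> F t) (at t within ?I)" using F t by (auto simp: continuous_on_def)
    ultimately have "((\<lambda>s. F s - c * m s * (f s - f t)) \<longlongrightarrow> F t - 0) (at t within ?I)"
      by (intro tendsto_diff)
    then show ?thesis unfolding g_def by simp
  qed
  have "((\<lambda>s. integral {0..s} g) has_real_derivative F t) (at t within ?I)"
    using integral_has_vector_derivative_continuous_at[OF g_int, of t "{}"] t tend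
    by (simp add: continuous_within g_def has_real_derivative_iff_has_vector_derivative)
  then have "((\<lambda>s. f 0 + integral {0..s} g) has_real_derivative F t) (at t within ?I)"
    by (auto intro!: derivative_eq_intros)
  then have "(A has_real_derivative F t) (at t within ?I)"
    by (rule has_field_derivative_transform_within[OF _ zero_less_one t]) (simp add: A_eq)
  then have "((\<lambda>s. A s - A t) has_real_derivative F t) (at t within ?I)"
    by (auto intro!: derivative_eq_intros)
  then have 1: "((\<lambda>s. (A s - A t) * exp (c * M s)) has_real_derivative F t * exp (c * M t)) (at t within ?I)"
    using M t by (intro has_real_derivative_mult_zero_left)
      (auto simp: continuous_on_eq_continuous_within intro!: continuous_intros)
  \<comment> \<open>At \<open>x = M t\<close> the bracket equals \<open>f t\<close>, which makes the
    two terms of the product rule cancel.\<close>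
  have "((\<lambda>x. (A t - c * f t * x) * exp (c * x)) has_real_derivative 0) (at (M t))"
    by (auto intro!: derivative_eq_intros simp: A_def algebra_simps)
  then have 2: "((\<lambda>s. (A t - c * f t * M s) * exp (c * M s)) has_real_derivative 0) (at t within ?I)"
    by (rule has_real_derivative_zero_compose_lipschitz) (use lip \<open>0 \<le> K\<close> in auto)
  have "(\<lambda>s. f s * exp (c * M s)) =
      (\<lambda>s. (A s - A t) * exp (c * M s) + (A t - c * f t * M s) * exp (c * M s))"
    by (simp add: A_def fun_eq_iff algebra_simps)
  with DERIV_add[OF 1 2] show ?thesis by simp
qed

text \<open>Since \<open>A t + C \<ge> 0\<close>, the function
  \<open>(h t)\<^sup>2 * exp (2 * C * t)\<close> is nondecreasing, so a zero propagates
  backwards.\<close>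

lemma linear_ode_zero_at_right_imp_zero_at_left:
  fixes h A :: "real \<Rightarrow> real"
  assumes "a \<le> b" and "h b = 0"
    and h: "\<And>t. t \<in> {a..b} \<Longrightarrow> (h has_real_derivative A t * h t) (at t within {a..b})"
    and A: "\<And>t. t \<in> {a..b} \<Longrightarrow> \<bar>A t\<bar> \<le> C"
  shows "h a = 0"
proof -
  define g where "g t = (h t)\<^sup>2 * exp (2 * C * t)" for t
  have "g a \<le> g b"
  proof (rule DERIV_nonneg_imp_increasing_open[OF \<open>a \<le> b\<close>])
    fix t assume t: "a < t" "t < b"
    then have "(h has_real_derivative A t * h t) (at t)"
      using h[of t] at_within_Icc_at[of a t b] by auto
    then have "(g has_real_derivative 2 * (A t + C) * ((h t)\<^sup>2 * exp (2 * C * t))) (at t)"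
      unfolding g_def by (auto intro!: derivative_eq_intros simp: power2_eq_square algebra_simps)
    moreover have "0 \<le> 2 * (A t + C) * ((h t)\<^sup>2 * exp (2 * C * t))"
      using A[of t] t by (intro mult_nonneg_nonneg) auto
    ultimately show "\<exists>y. DERIV g t :> y \<and> 0 \<le> y" by blast
  next
    have "continuous_on {a..b} h"
      by (rule DERIV_continuous_on) (rule h)
    then show "continuous_on {a..b} g"
      unfolding g_def by (intro continuous_intros)
  qed
  then have "(h a)\<^sup>2 * exp (2 * C * a) \<le> 0" using \<open>h b = 0\<close> by (simp add: g_def)
  then show ?thesis by (simp add: mult_le_0_iff)
qed

section \<open>Convolutions and power series\<close>

text \<open>Coefficient form of \<open>x (f\<^sup>2)' / 2 = x f' f\<close>, proved by averaging over
  \<open>l\<close> and \<open>k - l\<close>.\<close>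

lemma sum_index_convolution:
  fixes a :: "nat \<Rightarrow> real"
  shows "real k / 2 * (\<Sum>l\<le>k. a l * a (k - l)) = (\<Sum>l\<le>k. (real l * a l) * a (k - l))"
proof -
  let ?S = "\<Sum>l\<le>k. (real l * a l) * a (k - l)"
  have "?S = (\<Sum>l\<le>k. (real (k - l) * a (k - l)) * a l)"
    by (rule sum.reindex_bij_witness[of _ "\<lambda>l. k - l" "\<lambda>l. k - l"]) auto
  then have "?S + ?S = (\<Sum>l\<le>k. (real l * a l) * a (k - l) + (real (k - l) * a (k - l)) * a l)"
    by (simp add: sum.distrib)
  also have "\<dots> = (\<Sum>l\<le>k. real k * (a l * a (k - l)))"
    by (rule sum.cong) (auto simp: of_nat_diff algebra_simps)
  finally show ?thesis by (simp add: sum_distrib_left[symmetric])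
qed

text \<open>The terms of the geometric series differentiated twice; they majorise the termwise
  derivatives along characteristics.\<close>

lemma summable_quadratic_times_power:
  fixes z :: real
  assumes "0 \<le> z" "z < 1"
  shows "summable (\<lambda>k. (real k + 1) * (real k + 2) * z ^ k)"
proof -
  have s0: "summable (\<lambda>n. 1 * x ^ n)" if "norm x < 1" for x :: real
    using that by (simp add: summable_geometric)
  have s1: "summable (\<lambda>n. diffs (\<lambda>_. 1) n * x ^ n)" if "norm x < 1" for x :: real
    by (rule termdiff_converges[OF that]) (use s0 in auto)
  have "summable (\<lambda>n. diffs (diffs (\<lambda>_. 1)) n * z ^ n)"
    by (rule termdiff_converges[of z 1]) (use assms s1 in auto)
  then show ?thesis by (simp add: diffs_def algebra_simps)
qed

lemma self_le_exp_minus_one: "p \<le> exp (p - 1)" for p :: real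
  using exp_ge_add_one_self[of "p - 1"] by simp

section \<open>Generating functions of critical solutions\<close>

locale critical =
  fixes v :: "real \<Rightarrow> nat \<Rightarrow> real"
  assumes sol: "critical_solution v"
begin

definition m :: "real \<Rightarrow> real" where
  "m t = mass0 (v t)"

definition M :: "real \<Rightarrow> real" where
  "M t = integral {0..t} m"

text \<open>The value \<open>v t 0\<close> is unconstrained; replacing it by 0 lets all series start at index 0.\<close>

definition b :: "real \<Rightarrow> nat \<Rightarrow> real" where
  "b t k = (if k = 0 then 0 else v t k)"

definition w :: "nat \<Rightarrow> real \<Rightarrow> real" where
  "w k t = b t k * exp (real k * M t)"

definition G :: "real \<Rightarrow> real \<Rightarrow> real" where
  "G t x = (\<Sum>k. b t k * x ^ k)"

section \<open>Mass and its time integral\<close>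

lemma b_0 [simp]: "b t 0 = 0"
  by (simp add: b_def)

lemma b_nonneg: "0 \<le> t \<Longrightarrow> 0 \<le> b t k"
  using sol by (auto simp: critical_solution_def in_N_def b_def)

lemma b_sums: "0 \<le> t \<Longrightarrow> b t sums m t"
proof -
  assume "0 \<le> t"
  then have "summable (\<lambda>k. v t (Suc k))"
    using sol by (auto simp: critical_solution_def in_N_def)
  then have "(\<lambda>k. b t (Suc k)) sums m t"
    by (simp add: b_def m_def mass0_def summable_sums)
  then show "b t sums m t"
    by (subst (asm) sums_Suc_iff) simp
qed

lemma b_le: "0 \<le> t \<Longrightarrow> b t k \<le> m t"
  using sum_le_suminf[of "b t" "{k}"] b_sums[of t] b_nonneg by (auto simp: sums_iff)

lemma m_antimono: "0 \<le> s \<Longrightarrow> s \<le> t \<Longrightarrow> m t \<le> m s"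
  using sol by (auto simp: critical_solution_def mono_on_def m_def)

lemma m_pos: "0 \<le> t \<Longrightarrow> 0 < m t"
  using sol by (auto simp: critical_solution_def m_def)

lemma m_integrable: "0 \<le> s \<Longrightarrow> m integrable_on {s..t}"
proof -
  assume "0 \<le> s"
  then have "mono_on {s..t} (\<lambda>t. - m t)"
    by (auto simp: mono_on_def intro: m_antimono)
  then show ?thesis
    using integrable_on_mono_on integrable_neg by fastforce
qed

lemma M_diff: "0 \<le> s \<Longrightarrow> s \<le> t \<Longrightarrow> M t - M s = integral {s..t} m"
  using Henstock_Kurzweil_Integration.integral_combine[of 0 s t m] m_integrable by (simp add: M_def)

lemma M_0 [simp]: "M 0 = 0"
  by (simp add: M_def)

lemma M_diff_ge: "0 \<le> s \<Longrightarrow> s \<le> t \<Longrightarrow> (t - s) * m t \<le> M t - M s"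
  using integral_le[of "\<lambda>_. m t" "{s..t}" m] m_integrable[of s t]
  by (auto simp: M_diff m_antimono)

lemma M_diff_le: "0 \<le> s \<Longrightarrow> s \<le> t \<Longrightarrow> M t - M s \<le> (t - s) * m s"
  using integral_le[of m "{s..t}" "\<lambda>_. m s"] m_integrable[of s t]
  by (auto simp: M_diff m_antimono)

lemma M_diff_le_ln:
  assumes "0 < s" "s \<le> t" and "\<And>x. s \<le> x \<Longrightarrow> x \<le> t \<Longrightarrow> x * m x \<le> c"
  shows "M t - M s \<le> c * (ln t - ln s)"
proof -
  have 1: "((\<lambda>x. c * (1 / x)) has_integral c * (ln t - ln s)) {s..t}"
    using assms
    by (intro has_integral_mult_right fundamental_theorem_of_calculus)
      (auto intro!: derivative_eq_intros simp: has_real_derivative_iff_has_vector_derivative[symmetric])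
  have 2: "(m has_integral (M t - M s)) {s..t}"
    using m_integrable[of s t] assms by (simp add: M_diff integrable_integral)
  show ?thesis
  proof (rule has_integral_le[OF 2 1])
    fix x assume "x \<in> {s..t}"
    then show "m x \<le> c * (1 / x)" using assms by (simp add: pos_le_divide_eq mult.commute)
  qed
qed

section \<open>Equations for the coefficients\<close>

lemma convolution_b:
  "(\<Sum>l=1..k-1. v t l * v t (k - l)) = (\<Sum>l\<le>k. b t l * b t (k - l))"
  by (rule sum.mono_neutral_cong_left) (auto simp: b_def)

lemma v_has_integral:
  assumes "0 \<le> t"
  shows "((\<lambda>s. real k / 2 * (\<Sum>l\<le>k. b s l * b s (k - l)) - real k * b s k * m s)
    has_integral (b t k - b 0 k)) {0..t}"
proof (cases "k = 0")
  case False
  then have "((\<lambda>s. real k / 2 * (\<Sum>l=1..k-1. v s l * v s (k - l)) - real k * v s k * mass0 (v s))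
          has_integral (v t k - v 0 k)) {0..t}"
    using sol assms unfolding critical_solution_def by simp
  then show ?thesis
    using False by (simp only: convolution_b) (simp add: b_def m_def)
qed simp

lemma continuous_on_b: "continuous_on {0..T} (\<lambda>t. b t k)"
proof (cases "0 \<le> T")
  case True
  let ?g = "\<lambda>s. real k / 2 * (\<Sum>l\<le>k. b s l * b s (k - l)) - real k * b s k * m s"
  have "?g integrable_on {0..T}" using v_has_integral[OF True, of k] by blast
  then have "continuous_on {0..T} (\<lambda>t. b 0 k + integral {0..t} ?g)"
    by (intro continuous_intros indefinite_integral_continuous_1)
  moreover have "b 0 k + integral {0..t} ?g = b t k" if "t \<in> {0..T}" for t
    using integral_unique[OF v_has_integral[of t k]] that by simp
  ultimately show ?thesis by (rule continuous_on_eq)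
qed simp

text \<open>In terms of \<open>w\<close> the frozen mass disappears: the coefficients \<open>w k\<close> solve an autonomous
  triangular system, whose generating function solves Burgers' equation.\<close>

lemma w_has_derivative:
  assumes "t \<in> {0..T}"
  shows "(w k has_real_derivative (real k / 2 * (\<Sum>l\<le>k. w l t * w (k - l) t))) (at t within {0..T})"
proof -
  have "((\<lambda>s. b s k * exp (real k * integral {0..s} m)) has_real_derivative
     (real k / 2 * (\<Sum>l\<le>k. b t l * b t (k - l))) * exp (real k * integral {0..t} m)) (at t within {0..T})"
  proof (rule has_real_derivative_integrating_factor[where K = "m 0"])
    show "continuous_on {0..T} (\<lambda>t. real k / 2 * (\<Sum>l\<le>k. b t l * b t (k - l)))"
      by (intro continuous_intros continuous_on_b)
    show "\<And>s. s \<in> {0..T} \<Longrightarrow> \<bar>m s\<bar> \<le> m 0"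
      using m_antimono m_pos by (auto simp: less_imp_le)
  qed (use assms v_has_integral m_integrable in auto)
  moreover have "(\<Sum>l\<le>k. b t l * b t (k - l)) * exp (real k * M t) = (\<Sum>l\<le>k. w l t * w (k - l) t)"
    unfolding sum_distrib_right
  proof (rule sum.cong)
    fix l assume "l \<in> {..k}"
    then have "exp (real k * M t) = exp (real l * M t) * exp (real (k - l) * M t)"
      by (simp add: exp_add[symmetric] of_nat_diff algebra_simps)
    then show "b t l * b t (k - l) * exp (real k * M t) = w l t * w (k - l) t"
      by (simp add: w_def)
  qed simp
  ultimately show ?thesis
    by (simp add: w_def[abs_def] M_def mult.assoc)
qed

section \<open>The generating function on the unit interval\<close>

lemma G_sums:
  assumes "0 \<le> t" "0 \<le> x" "x \<le> 1"
  shows "(\<lambda>k. b t k * x ^ k) sums G t x"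
proof -
  have "summable (\<lambda>k. b t k * x ^ k)"
  proof (rule summable_comparison_test')
    show "summable (b t)" using b_sums[OF assms(1)] by (simp add: sums_iff)
    fix k
    show "norm (b t k * x ^ k) \<le> b t k"
      using assms b_nonneg[of t k] by (simp add: abs_mult mult_left_le power_le_one)
  qed
  then show ?thesis by (simp add: G_def summable_sums)
qed

lemma G_mono: "0 \<le> t \<Longrightarrow> 0 \<le> x \<Longrightarrow> x \<le> y \<Longrightarrow> y \<le> 1 \<Longrightarrow> G t x \<le> G t y"
  by (rule sums_le[OF _ G_sums G_sums]) (auto intro!: mult_left_mono power_mono b_nonneg)

lemma G_1: "0 \<le> t \<Longrightarrow> G t 1 = m t"
  using b_sums by (simp add: G_def sums_iff)

text \<open>Characteristics are only available for \<open>z < 1\<close>. Each partial sum is a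
  polynomial in \<open>z\<close>, so the bound survives \<open>z -> 1\<close>.\<close>

lemma m_le_if_G_le:
  assumes "0 \<le> t" and B: "\<And>z. 0 < z \<Longrightarrow> z < 1 \<Longrightarrow> G t z \<le> B"
  shows "m t \<le> B"
proof -
  have "(\<Sum>k<n. b t k) \<le> B" for n
  proof (rule tendsto_le[OF _ tendsto_const])
    have "isCont (\<lambda>z::real. \<Sum>k<n. b t k * z ^ k) 1" by (intro continuous_intros)
    then have "((\<lambda>z::real. \<Sum>k<n. b t k * z ^ k) \<longlongrightarrow> (\<Sum>k<n. b t k * 1 ^ k)) (at_left 1)"
      unfolding isCont_def by (rule filterlim_mono) (auto simp: at_within_le_at)
    then show "((\<lambda>z::real. \<Sum>k<n. b t k * z ^ k) \<longlongrightarrow> (\<Sum>k<n. b t k)) (at_left 1)" by simp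
    have "\<forall>\<^sub>F z in at_left 1. z \<in> {0<..<1::real}"
      by (rule eventually_at_left_real) simp
    then show "\<forall>\<^sub>F z in at_left 1. (\<Sum>k<n. b t k * z ^ k) \<le> B"
    proof eventually_elim
      case (elim z)
      have "(\<Sum>k<n. b t k * z ^ k) \<le> G t z"
        using sum_le_suminf[of "\<lambda>k. b t k * z ^ k" "{..<n}"] G_sums[of t z] assms(1) elim
        by (auto simp: sums_iff b_nonneg)
      then show ?case using B[of z] elim by simp
    qed
  qed simp
  then show ?thesis
    using b_sums[OF assms(1)] by (auto simp: sums_def intro: LIMSEQ_le_const2)
qed

text \<open>Method of characteristics. Backwards in time the characteristic \<open>\<zeta>\<close> through \<open>(T, z)\<close> stays in
  the unit interval because the mass is nonincreasing, and \<open>h t = G t (\<zeta> t) - G T z\<close> solves a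
  homogeneous linear equation.\<close>

lemma G_characteristic:
  assumes T: "0 \<le> T" and z: "0 \<le> z" "z < 1"
  defines "u \<equiv> G T z"
  defines "\<xi> \<equiv> z * exp (T * u - M T)"
  shows "\<xi> \<le> z" and "G 0 \<xi> = u"
proof -
  define \<zeta> where "\<zeta> t = z * exp (M t - M T + (T - t) * u)" for t
  define a where "a k t = b t k * \<zeta> t ^ k" for k t
  define a' where "a' k t = real k / 2 * (\<Sum>l\<le>k. a l t * a (k - l) t) - real k * u * a k t" for k t
  let ?I = "{0..T}"
  have "u \<le> m T" using G_mono[of T z 1] G_1 T z by (simp add: u_def)
  have "0 \<le> u" using G_mono[of T 0 z] T z by (simp add: u_def G_def powser_zero)
  have \<zeta>: "0 \<le> \<zeta> t \<and> \<zeta> t \<le> z" if t: "t \<in> ?I" for t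
  proof -
    \<comment> \<open>\<open>u\<close> is at most the least value \<open>m T\<close> of
      \<open>m\<close> on \<open>{t..T}\<close>, so the exponent is nonpositive.\<close>
    have "(T - t) * u \<le> (T - t) * m T" using \<open>u \<le> m T\<close> t by (intro mult_left_mono) auto
    then have "M t - M T + (T - t) * u \<le> 0" using M_diff_ge[of t T] t by simp
    then show ?thesis using z by (simp add: \<zeta>_def mult_left_le)
  qed
  have \<zeta>0: "\<zeta> 0 = \<xi>" by (simp add: \<zeta>_def \<xi>_def)
  show "\<xi> \<le> z" using \<zeta>[of 0] \<zeta>0 T by auto
  have a_nonneg: "0 \<le> a k t" if "t \<in> ?I" for k t
    using \<zeta>[OF that] b_nonneg[of t k] that by (simp add: a_def)
  have a_le: "a k t \<le> m 0 * z ^ k" if t: "t \<in> ?I" for k t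
    unfolding a_def using \<zeta>[OF t] t b_le[of t k] m_antimono[of 0 t] m_pos[of 0]
    by (intro mult_mono power_mono) auto
  have sum_a: "(\<lambda>k. a k t) sums G t (\<zeta> t)" if t: "t \<in> ?I" for t
    unfolding a_def using t \<zeta>[OF t] z by (intro G_sums) auto
  \<comment> \<open>The factor \<open>exp (k * M t)\<close> of \<open>\<zeta> t ^ k\<close> turns
    \<open>b t k\<close> into \<open>w k t\<close>; the rest is smooth in \<open>t\<close>, so
    \<open>a k\<close> is differentiable even where \<open>m\<close> jumps.\<close>
  have a_w: "a k t = w k t * ((z * exp (- M T)) ^ k * exp (real k * ((T - t) * u)))" for k t
  proof -
    have "\<zeta> t = exp (M t) * ((z * exp (- M T)) * exp ((T - t) * u))"
      by (simp add: \<zeta>_def exp_add exp_diff exp_minus field_simps)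
    then have "\<zeta> t ^ k = exp (real k * M t) * ((z * exp (- M T)) ^ k * exp (real k * ((T - t) * u)))"
      by (simp only: power_mult_distrib exp_of_nat_mult)
    then show ?thesis
      by (simp only: a_def w_def mult_ac)
  qed
  have a_deriv: "(a k has_real_derivative a' k t) (at t within ?I)" if t: "t \<in> ?I" for k t
  proof -
    define c where "c = (z * exp (- M T)) ^ k"
    have "((\<lambda>t. c * exp (real k * ((T - t) * u))) has_real_derivative
        c * (exp (real k * ((T - t) * u)) * (real k * (- u)))) (at t within ?I)"
      by (auto intro!: derivative_eq_intros)
    moreover have "a k = (\<lambda>t. w k t * (c * exp (real k * ((T - t) * u))))"
      by (rule ext) (simp only: a_w c_def)
    ultimately have deriv: "(a k has_real_derivative
       (real k / 2 * (\<Sum>l\<le>k. w l t * w (k - l) t)) * (c * exp (real k * ((T - t) * u)))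
         + c * (exp (real k * ((T - t) * u)) * (real k * (- u))) * w k t) (at t within ?I)"
      using DERIV_mult[OF w_has_derivative[OF t]] by (simp only:)
    have conv: "(\<Sum>l\<le>k. w l t * w (k - l) t) * (c * exp (real k * ((T - t) * u)))
        = (\<Sum>l\<le>k. a l t * a (k - l) t)"
      unfolding sum_distrib_right
    proof (rule sum.cong)
      fix l assume "l \<in> {..k}"
      then have k: "k = l + (k - l)" by simp
      have "c = (z * exp (- M T)) ^ l * (z * exp (- M T)) ^ (k - l)"
        unfolding c_def by (subst k) (rule power_add)
      moreover have "exp (real k * ((T - t) * u)) = exp (real l * ((T - t) * u)) * exp (real (k - l) * ((T - t) * u))"
        by (subst k) (simp add: exp_add[symmetric] algebra_simps del: le_add_diff_inverse)
      ultimately show "w l t * w (k - l) t * (c * exp (real k * ((T - t) * u))) = a l t * a (k - l) t"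
        by (simp add: a_w)
    qed simp
    have drift: "c * (exp (real k * ((T - t) * u)) * (real k * (- u))) * w k t = - (real k * u * a k t)"
      by (simp add: a_w c_def)
    show ?thesis
      using deriv unfolding drift mult.assoc[of "real k / 2"] conv a'_def by simp
  qed
  \<comment> \<open>Majorant uniform in \<open>t\<close>, from
    \<open>a k t \<le> m 0 * z ^ k\<close>: the convolution has \<open>k + 1\<close> terms, and
    \<open>k + 2\<close> covers the factor \<open>k / 2\<close>.\<close>
  define B where "B k = ((m 0)\<^sup>2 + m 0 * u) * ((real k + 1) * (real k + 2) * z ^ k)" for k
  have sB: "summable B"
    unfolding B_def using z by (rule summable_mult[OF summable_quadratic_times_power])
  have a'_le: "norm (a' k t) \<le> B k" if t: "t \<in> ?I" for k t
  proof -
    have "a l t * a (k - l) t \<le> (m 0)\<^sup>2 * z ^ k" if "l \<le> k" for l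
    proof -
      have "a l t * a (k - l) t \<le> (m 0 * z ^ l) * (m 0 * z ^ (k - l))"
        using a_le[OF t] a_nonneg[OF t] m_pos[of 0] z by (intro mult_mono) auto
      also have "\<dots> = (m 0)\<^sup>2 * z ^ (l + (k - l))" by (simp add: power_add power2_eq_square del: le_add_diff_inverse)
      finally show ?thesis using that by simp
    qed
    then have "(\<Sum>l\<le>k. a l t * a (k - l) t) \<le> (real k + 1) * ((m 0)\<^sup>2 * z ^ k)"
      using sum_bounded_above[of "{..k}" "\<lambda>l. a l t * a (k - l) t" "(m 0)\<^sup>2 * z ^ k"] by (simp add: add.commute)
    then have "real k / 2 * (\<Sum>l\<le>k. a l t * a (k - l) t) \<le> real k / 2 * ((real k + 1) * ((m 0)\<^sup>2 * z ^ k))"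
      by (intro mult_left_mono) auto
    also have "\<dots> \<le> (real k + 2) * ((real k + 1) * ((m 0)\<^sup>2 * z ^ k))"
      using z by (intro mult_right_mono) auto
    finally have 1: "real k / 2 * (\<Sum>l\<le>k. a l t * a (k - l) t) \<le> (m 0)\<^sup>2 * ((real k + 1) * (real k + 2) * z ^ k)"
      by (simp add: mult_ac)
    have "real k * u * a k t \<le> real k * u * (m 0 * z ^ k)"
      using a_le[OF t] \<open>0 \<le> u\<close> by (intro mult_left_mono) auto
    also have "\<dots> = m 0 * u * (real k * z ^ k)" by simp
    also have "\<dots> \<le> m 0 * u * ((real k + 1) * (real k + 2) * z ^ k)"
      using \<open>0 \<le> u\<close> m_pos[of 0] z
      by (intro mult_left_mono mult_right_mono) (auto simp: algebra_simps)
    finally have 2: "real k * u * a k t \<le> m 0 * u * ((real k + 1) * (real k + 2) * z ^ k)" .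
    have "0 \<le> real k / 2 * (\<Sum>l\<le>k. a l t * a (k - l) t)" "0 \<le> real k * u * a k t"
      using a_nonneg[OF t] \<open>0 \<le> u\<close> by (auto intro!: mult_nonneg_nonneg sum_nonneg)
    with 1 2 show ?thesis by (simp add: a'_def B_def distrib_right)
  qed
  have unif: "uniform_limit ?I (\<lambda>n t. \<Sum>k<n. a' k t) (\<lambda>t. \<Sum>k. a' k t) sequentially"
    using a'_le sB by (rule Weierstrass_m_test)
  obtain g where g: "\<And>t. t \<in> ?I \<Longrightarrow> (\<lambda>k. a k t) sums g t"
      "\<And>t. t \<in> ?I \<Longrightarrow> (g has_real_derivative (\<Sum>k. a' k t)) (at t within ?I)"
    using has_field_derivative_series[OF convex_closed_interval a_deriv unif, of T] sum_a[of T] T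
    by (auto simp: sums_iff)
  have g_eq: "g t = G t (\<zeta> t)" if "t \<in> ?I" for t
    using g(1)[OF that] sum_a[OF that] by (rule sums_unique2)
  define A where "A t = (\<Sum>k. real k * a k t)" for t
  have sA: "summable (\<lambda>k. real k * a k t)" and A_le: "\<bar>A t\<bar> \<le> (\<Sum>k. m 0 * ((real k + 1) * (real k + 2) * z ^ k))"
    if t: "t \<in> ?I" for t
  proof -
    have le: "norm (real k * a k t) \<le> m 0 * ((real k + 1) * (real k + 2) * z ^ k)" for k
    proof -
      have "real k * a k t \<le> real k * (m 0 * z ^ k)"
        using a_le[OF t] by (intro mult_left_mono) auto
      also have "\<dots> = m 0 * (real k * z ^ k)" by simp
      also have "\<dots> \<le> m 0 * ((real k + 1) * (real k + 2) * z ^ k)"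
        using m_pos[of 0] z by (intro mult_left_mono mult_right_mono) (auto simp: algebra_simps)
      finally show ?thesis using a_nonneg[OF t] by simp
    qed
    have s: "summable (\<lambda>k. m 0 * ((real k + 1) * (real k + 2) * z ^ k))"
      using z by (rule summable_mult[OF summable_quadratic_times_power])
    show "summable (\<lambda>k. real k * a k t)"
      by (rule summable_comparison_test'[OF s le])
    show "\<bar>A t\<bar> \<le> (\<Sum>k. m 0 * ((real k + 1) * (real k + 2) * z ^ k))"
      using norm_suminf_le[OF le s] by (simp add: A_def)
  qed
  have a'_sum: "(\<Sum>k. a' k t) = A t * (g t - u)" if t: "t \<in> ?I" for t
  proof -
    have "(\<lambda>k. \<Sum>l\<le>k. (real l * a l t) * a (k - l) t) sums (A t * (\<Sum>k. a k t))"
      unfolding A_def using sA[OF t] g(1)[OF t] a_nonneg[OF t]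
      by (intro Cauchy_product_sums) (auto simp: sums_iff abs_mult)
    then have "(\<lambda>k. real k / 2 * (\<Sum>l\<le>k. a l t * a (k - l) t)) sums (A t * g t)"
      by (simp only: sum_index_convolution[of _ "\<lambda>l. a l t"] sums_unique[OF g(1)[OF t], symmetric])
    moreover have "(\<lambda>k. u * (real k * a k t)) sums (u * A t)"
      unfolding A_def by (rule sums_mult[OF summable_sums[OF sA[OF t]]])
    ultimately have "(\<lambda>k. real k / 2 * (\<Sum>l\<le>k. a l t * a (k - l) t) - u * (real k * a k t)) sums (A t * g t - u * A t)"
      by (rule sums_diff)
    then have "(\<lambda>k. a' k t) sums (A t * g t - u * A t)"
      by (simp add: a'_def mult_ac)
    then show ?thesis by (simp add: sums_iff algebra_simps)
  qed
  have "g 0 - u = 0"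
  proof (rule linear_ode_zero_at_right_imp_zero_at_left[OF T])
    show "g T - u = 0" using g_eq[of T] T by (simp add: \<zeta>_def u_def)
    fix t assume t: "t \<in> ?I"
    show "((\<lambda>t. g t - u) has_real_derivative A t * (g t - u)) (at t within ?I)"
      using g(2)[OF t] a'_sum[OF t] by (auto intro!: derivative_eq_intros)
    show "\<bar>A t\<bar> \<le> (\<Sum>k. m 0 * ((real k + 1) * (real k + 2) * z ^ k))"
      by (rule A_le[OF t])
  qed
  then show "G 0 \<xi> = u" using g_eq[of 0] T \<zeta>0 by simp
qed

end

section \<open>Asymptotics\<close>

context critical
begin

text \<open>Compare the characteristics through \<open>(T, z)\<close> and \<open>(T, z')\<close> with \<open>z < z'\<close>: as \<open>G 0 x / x\<close> is
  nondecreasing, the ratio \<open>r = \<xi>' / \<xi>\<close> satisfies \<open>u' \<ge> r u\<close>, and \<open>z' / z > 1\<close> becomes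
  \<open>T u (r - 1) < ln r\<close>.\<close>

lemma time_G_less_1:
  assumes T: "0 \<le> T" and z: "0 < z" "z < 1"
  shows "T * G T z < 1"
proof -
  define z' where "z' = (1 + z) / 2"
  have z': "z < z'" "z' < 1" using z by (auto simp: z'_def)
  define u u' \<xi> \<xi>' where "u = G T z" and "u' = G T z'"
    and "\<xi> = z * exp (T * u - M T)" and "\<xi>' = z' * exp (T * u' - M T)"
  have "u \<le> u'" unfolding u_def u'_def using T z z' by (intro G_mono) auto
  have c: "\<xi> \<le> z" "G 0 \<xi> = u" "\<xi>' \<le> z'" "G 0 \<xi>' = u'"
    using G_characteristic[OF T, of z] G_characteristic[OF T, of z'] z z'
    by (auto simp: u_def u'_def \<xi>_def \<xi>'_def)
  define r where "r = \<xi>' / \<xi>"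
  have "0 < \<xi>" using z by (simp add: \<xi>_def)
  have r_eq: "r = (z' / z) * exp (T * (u' - u))"
    by (simp add: r_def \<xi>_def \<xi>'_def exp_diff right_diff_distrib)
  have "1 < z' / z" "1 \<le> exp (T * (u' - u))" using z z' T \<open>u \<le> u'\<close> by auto
  then have "1 * 1 < r" unfolding r_eq by (intro mult_less_le_imp_less) auto
  then have r: "1 < r" by simp
  have \<xi>': "\<xi>' = r * \<xi>" using \<open>0 < \<xi>\<close> by (simp add: r_def)
  have "r * u \<le> u'"
  proof (rule sums_le)
    show "(\<lambda>k. r * (b 0 k * \<xi> ^ k)) sums (r * u)"
      using G_sums[of 0 \<xi>] \<open>0 < \<xi>\<close> c z by (intro sums_mult) auto
    show "(\<lambda>k. b 0 k * \<xi>' ^ k) sums u'"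
      using G_sums[of 0 \<xi>'] \<xi>' r \<open>0 < \<xi>\<close> c z' by auto
    fix k
    \<comment> \<open>\<open>r \<le> r ^ k\<close> fails at \<open>k = 0\<close>, but there both
      sides vanish as \<open>b 0 0 = 0\<close>.\<close>
    show "r * (b 0 k * \<xi> ^ k) \<le> b 0 k * \<xi>' ^ k"
    proof (cases k)
      case (Suc j)
      then have "r \<le> r ^ k" using r self_le_power[of r k] by simp
      then have "r * (b 0 k * \<xi> ^ k) \<le> r ^ k * (b 0 k * \<xi> ^ k)"
        using \<open>0 < \<xi>\<close> b_nonneg[of 0 k] by (intro mult_right_mono) auto
      then show ?thesis by (simp add: \<xi>' power_mult_distrib mult_ac)
    qed simp
  qed
  have "0 < ln (z' / z)" using \<open>1 < z' / z\<close> by simp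
  also have "ln (z' / z) = ln r - T * (u' - u)"
    using \<open>1 < z' / z\<close> unfolding r_eq by (subst ln_mult_pos) auto
  also have "\<dots> \<le> (r - 1) - T * (u' - u)"
    using ln_le_minus_one[of r] r by simp
  also have "\<dots> \<le> (r - 1) - T * ((r - 1) * u)"
    using \<open>r * u \<le> u'\<close> T by (intro diff_left_mono mult_left_mono) (auto simp: algebra_simps)
  finally have "0 < (r - 1) * (1 - T * u)" by (simp add: algebra_simps)
  then show ?thesis using r by (simp add: zero_less_mult_iff u_def)
qed

lemma time_m_le_1:
  assumes "0 \<le> t"
  shows "t * m t \<le> 1"
proof (cases "t = 0")
  case False
  then have "m t \<le> 1 / t"
    using assms by (intro m_le_if_G_le) (auto simp: field_simps intro: less_imp_le time_G_less_1)
  then show ?thesis using assms False by (simp add: field_simps)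
qed simp

text \<open>Keeping only the linear term of \<open>u = G 0 \<xi>\<close> gives
  \<open>T * b 0 1 * \<xi> \<le> T * u \<le> exp (T * u - 1)\<close>. As \<open>\<xi>\<close>
  carries the factor \<open>exp (T * u)\<close>, \<open>u\<close> cancels; then
  \<open>z -> 1\<close>.\<close>

lemma b_1_le_M:
  assumes T: "0 \<le> T"
  shows "T * b 0 1 * exp (- M T) \<le> exp (- 1)"
proof -
  have "z * (T * b 0 1 * exp (- M T)) \<le> exp (- 1)" if z: "z \<in> {0<..<1}" for z
  proof -
    define u where "u = G T z"
    define \<xi> where "\<xi> = z * exp (T * u - M T)"
    have \<xi>: "\<xi> \<le> z" "G 0 \<xi> = u" "0 < \<xi>"
      using G_characteristic[OF T, of z] z by (auto simp: u_def \<xi>_def)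
    have "b 0 1 * \<xi> \<le> G 0 \<xi>"
      using sum_le_suminf[of "\<lambda>k. b 0 k * \<xi> ^ k" "{1}"] G_sums[of 0 \<xi>] \<xi> z
      by (auto simp: sums_iff b_nonneg)
    then have "T * (b 0 1 * \<xi>) \<le> T * u" using T \<xi> by (intro mult_left_mono) auto
    also have "\<dots> \<le> exp (T * u - 1)" by (rule self_le_exp_minus_one)
    finally have "exp (T * u) * (z * (T * b 0 1 * exp (- M T))) \<le> exp (T * u) * exp (- 1)"
      by (simp add: \<xi>_def exp_diff exp_minus field_simps)
    then show ?thesis by simp
  qed
  moreover have "((\<lambda>z. z * (T * b 0 1 * exp (- M T))) \<longlongrightarrow> 1 * (T * b 0 1 * exp (- M T))) (at_left 1)"
    by (intro tendsto_intros)
  moreover have "\<forall>\<^sub>F z in at_left 1. z \<in> {0<..<1::real}"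
    by (rule eventually_at_left_real) simp
  ultimately show ?thesis
    by (intro tendsto_upperbound[of "\<lambda>z. z * (T * b 0 1 * exp (- M T))" _ "at_left 1"])
      (auto elim: eventually_mono)
qed

text \<open>\<open>X\<close> is \<open>\<xi>\<close> with \<open>z = 1\<close> and
  \<open>u = m T\<close>, and bounds every \<open>\<xi>\<close>. As \<open>\<xi> < 1\<close>, the
  terms of \<open>G 0 \<xi>\<close> of index at least 2 sum to at most
  \<open>m 0 * \<xi>\<^sup>2\<close>.\<close>

lemma m_le_G_0:
  assumes T: "0 \<le> T"
  defines "X \<equiv> exp (T * m T - M T)"
  shows "m T \<le> b 0 1 * X + m 0 * X\<^sup>2"
proof (rule m_le_if_G_le[OF T])
  fix z :: real assume z: "0 < z" "z < 1"
  define u where "u = G T z"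
  define \<xi> where "\<xi> = z * exp (T * u - M T)"
  have \<xi>: "\<xi> \<le> z" "G 0 \<xi> = u" "0 < \<xi>"
    using G_characteristic[OF T, of z] z by (auto simp: u_def \<xi>_def)
  have "u \<le> m T" using G_mono[of T z 1] G_1 T z by (simp add: u_def)
  then have "exp (T * u - M T) \<le> X" using T by (auto simp: X_def intro: mult_left_mono)
  moreover have "\<xi> \<le> exp (T * u - M T)"
    unfolding \<xi>_def using z by (intro mult_left_le_one_le) auto
  ultimately have "\<xi> \<le> X" by linarith
  have "u \<le> b 0 1 * \<xi> + m 0 * \<xi>\<^sup>2"
  proof (rule sums_le)
    show "(\<lambda>k. b 0 k * \<xi> ^ k) sums u" using G_sums[of 0 \<xi>] \<xi> z by auto
    show "(\<lambda>k. (if k = 1 then b 0 1 * \<xi> else 0) + b 0 k * \<xi>\<^sup>2) sums (b 0 1 * \<xi> + m 0 * \<xi>\<^sup>2)"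
      using sums_If_finite_set[of "{1}" "\<lambda>_. b 0 1 * \<xi>"] b_sums[of 0]
      by (intro sums_add sums_mult2) auto
    fix k
    show "b 0 k * \<xi> ^ k \<le> (if k = 1 then b 0 1 * \<xi> else 0) + b 0 k * \<xi>\<^sup>2"
    proof (cases "k \<ge> 2")
      case True
      then have "\<xi> ^ k \<le> \<xi>\<^sup>2" using \<xi> z by (intro power_decreasing) auto
      then show ?thesis using True b_nonneg[of 0 k] by (simp add: mult_left_mono)
    next
      case False
      then have "k = 0 \<or> k = 1" by auto
      then show ?thesis using b_nonneg[of 0 1] by auto
    qed
  qed
  also have "\<dots> \<le> b 0 1 * X + m 0 * X\<^sup>2"
    using \<open>\<xi> \<le> X\<close> \<xi>(3) b_nonneg[of 0 1] m_pos[of 0]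
    by (intro add_mono mult_left_mono power_mono) auto
  finally show "G T z \<le> b 0 1 * X + m 0 * X\<^sup>2" by (simp add: u_def)
qed

end

section \<open>Convergence of \<open>M t - ln t\<close> and of \<open>t * m t\<close>\<close>

locale critical_positive = critical +
  assumes v_1_pos: "0 < v 0 1"
begin

lemma b_1_pos: "0 < b 0 1"
  using v_1_pos by (simp add: b_def)

lemma M_minus_ln_ge:
  assumes "0 < t"
  shows "1 + ln (b 0 1) \<le> M t - ln t"
proof -
  have "ln (t * b 0 1 * exp (- M t)) \<le> ln (exp (- 1))"
    using b_1_le_M[of t] assms b_1_pos by (intro ln_mono) auto
  then show ?thesis
    using assms b_1_pos by (simp add: ln_mult_pos)
qed

lemma M_minus_ln_antimono:
  assumes "0 < s" "s \<le> t"
  shows "M t - ln t \<le> M s - ln s"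
  using M_diff_le_ln[of s t 1] time_m_le_1 assms by simp

text \<open>If \<open>M t - ln t\<close> stayed above its lower bound by \<open>\<delta>\<close>, then \<open>t m(t)\<close> would stay away from 1,
  and \<open>M t - ln t\<close> would tend to \<open>-\<infinity>\<close>.\<close>

lemma M_minus_ln_less:
  assumes "0 < \<delta>"
  shows "\<exists>t>0. M t - ln t < 1 + ln (b 0 1) + \<delta>"
proof (rule ccontr)
  assume "\<not> ?thesis"
  then have large: "1 + ln (b 0 1) + \<delta> \<le> M t - ln t" if "0 < t" for t
    using that by (meson not_less)
  define \<beta> where "\<beta> = b 0 1"
  have "0 < \<beta>" using b_1_pos by (simp add: \<beta>_def)
  \<comment> \<open>Chosen so that
    \<open>t * m 0 * X\<^sup>2 = (C / t) * (t * \<beta> * X)\<^sup>2\<close>.\<close>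
  define C where "C = m 0 / \<beta>\<^sup>2"
  \<comment> \<open>Half of \<open>\<delta>\<close> is kept back:
    \<open>exp (- \<delta>) / q = q\<close>, so a factor \<open>1 + C / t \<le> 1 / q\<close> still
    leaves a bound below 1.\<close>
  define q where "q = exp (- \<delta> / 2)"
  have q: "0 < q" "q < 1" using assms by (auto simp: q_def)
  have "0 < C" using m_pos[of 0] \<open>0 < \<beta>\<close> by (simp add: C_def)
  \<comment> \<open>For \<open>p = t * m t\<close>, \<open>m_le_G_0\<close> yields a bound on
    \<open>p * exp (1 - p)\<close>; replacing \<open>exp (1 - p)\<close> by the smaller
    \<open>2 - p\<close> makes it one on \<open>1 - (1 - p)\<^sup>2\<close>.\<close>
  have bound: "t * m t * (2 - t * m t) \<le> exp (- \<delta>) * (1 + C / t)" if t: "0 < t" for t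
  proof -
    define p where "p = t * m t"
    define X where "X = exp (p - M t)"
    have p: "0 < p" "p \<le> 1" using t m_pos[of t] time_m_le_1[of t] by (auto simp: p_def)
    have "p - M t \<le> (p - 1 - \<delta>) - ln (t * \<beta>)"
      using large[OF t] t \<open>0 < \<beta>\<close> by (simp add: ln_mult_pos \<beta>_def)
    then have "X \<le> exp ((p - 1 - \<delta>) - ln (t * \<beta>))" by (simp add: X_def)
    also have "\<dots> = exp (p - 1) * exp (- \<delta>) / (t * \<beta>)"
      using t \<open>0 < \<beta>\<close> by (simp add: exp_diff[of _ "ln (t * \<beta>)"] exp_add[symmetric])
    finally have X: "t * \<beta> * X \<le> exp (p - 1) * exp (- \<delta>)"
      using t \<open>0 < \<beta>\<close> by (simp add: field_simps)
    have "exp (p - 1) * exp (- \<delta>) \<le> 1 * 1"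
      using p assms by (intro mult_mono) auto
    with X have X1: "t * \<beta> * X \<le> 1" by simp
    have "0 < X" by (simp add: X_def)
    have "p \<le> t * (\<beta> * X + m 0 * X\<^sup>2)"
      using m_le_G_0[of t] t unfolding p_def X_def \<beta>_def by (intro mult_left_mono) auto
    also have "\<dots> = t * \<beta> * X * (1 + (C / t) * (t * \<beta> * X))"
      using t \<open>0 < \<beta>\<close> by (simp add: C_def field_simps power2_eq_square)
    also have "\<dots> \<le> t * \<beta> * X * (1 + (C / t) * 1)"
      using X1 t \<open>0 < \<beta>\<close> \<open>0 < X\<close> \<open>0 < C\<close> by (intro mult_left_mono add_left_mono) auto
    also have "\<dots> \<le> exp (p - 1) * exp (- \<delta>) * (1 + C / t)"
      using X t \<open>0 < C\<close> by (intro order.trans[OF mult_right_mono[OF X]]) auto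
    finally have "p * exp (1 - p) \<le> exp (p - 1) * exp (- \<delta>) * (1 + C / t) * exp (1 - p)"
      by (intro mult_right_mono) auto
    also have "\<dots> = exp (- \<delta>) * (1 + C / t)"
      by (simp add: exp_diff field_simps)
    finally have "p * exp (1 - p) \<le> exp (- \<delta>) * (1 + C / t)" .
    moreover have "p * (2 - p) \<le> p * exp (1 - p)"
      using p exp_ge_add_one_self[of "1 - p"] by (intro mult_left_mono) auto
    ultimately show ?thesis by (simp add: p_def)
  qed
  \<comment> \<open>For \<open>p \<le> 1\<close>, \<open>1 - (1 - p)\<^sup>2 \<le> q\<close> means
    \<open>1 - p \<ge> \<kappa>\<close>. The time \<open>t1\<close> below solves
    \<open>1 + C / t1 = 1 / q\<close>.\<close>
  define \<kappa> where "\<kappa> = sqrt (1 - q)"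
  have "0 < \<kappa>" using q by (simp add: \<kappa>_def)
  define t1 where "t1 = C / (1 / q - 1)"
  have "0 < t1" using q \<open>0 < C\<close> by (simp add: t1_def field_simps)
  have small: "t * m t \<le> 1 - \<kappa>" if t: "t1 \<le> t" for t
  proof -
    have "0 < t" using t \<open>0 < t1\<close> by simp
    have "C \<le> t * (1 / q - 1)" using t q by (simp add: t1_def pos_divide_le_eq)
    then have "1 + C / t \<le> 1 / q" using \<open>0 < t\<close> by (simp add: field_simps)
    then have "exp (- \<delta>) * (1 + C / t) \<le> exp (- \<delta>) * (1 / q)"
      by (intro mult_left_mono) auto
    also have "\<dots> = q" by (simp add: q_def exp_diff[symmetric])
    finally have "t * m t * (2 - t * m t) \<le> q" using bound[OF \<open>0 < t\<close>] by simp
    then have "1 - q \<le> (1 - t * m t)\<^sup>2" by (simp add: power2_eq_square algebra_simps)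
    then have "\<kappa> \<le> sqrt ((1 - t * m t)\<^sup>2)" unfolding \<kappa>_def by (rule real_sqrt_le_mono)
    also have "\<dots> = 1 - t * m t" using time_m_le_1[of t] \<open>0 < t\<close> by simp
    finally show ?thesis by simp
  qed
  define E where "E = M t1 - ln t1 - ln (b 0 1)"
  \<comment> \<open>This \<open>t\<close> makes the loss \<open>\<kappa> * (ln t - ln t1)\<close>
    equal to \<open>\<bar>E\<bar>\<close>, so \<open>M t - ln t - ln (b 0 1) \<le> 0\<close>,
    although it must be at least 1.\<close>
  define t where "t = t1 * exp (\<bar>E\<bar> / \<kappa>)"
  have t: "t1 \<le> t" using \<open>0 < t1\<close> \<open>0 < \<kappa>\<close> by (simp add: t_def)
  have "ln t - ln t1 = \<bar>E\<bar> / \<kappa>" using \<open>0 < t1\<close> by (simp add: t_def ln_mult_pos)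
  then have "\<kappa> * (ln t - ln t1) = \<bar>E\<bar>" using \<open>0 < \<kappa>\<close> by simp
  moreover have "M t - M t1 \<le> (1 - \<kappa>) * (ln t - ln t1)"
    using small t \<open>0 < t1\<close> by (intro M_diff_le_ln) auto
  ultimately have "M t - ln t - ln (b 0 1) \<le> E - \<bar>E\<bar>"
    by (simp add: E_def algebra_simps)
  then show False using M_minus_ln_ge[of t] t \<open>0 < t1\<close> by simp
qed

lemma M_minus_ln_tendsto: "((\<lambda>t. M t - ln t) \<longlongrightarrow> 1 + ln (b 0 1)) at_top"
proof (rule order_tendstoI)
  fix a assume "a < 1 + ln (b 0 1)"
  then show "\<forall>\<^sub>F t in at_top. a < M t - ln t"
    using M_minus_ln_ge by (intro eventually_mono[OF eventually_gt_at_top[of 0]]) (auto intro: less_le_trans)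
next
  fix a assume "1 + ln (b 0 1) < a"
  then obtain s where s: "0 < s" "M s - ln s < a"
    using M_minus_ln_less[of "a - (1 + ln (b 0 1))"] by auto
  show "\<forall>\<^sub>F t in at_top. M t - ln t < a"
    using M_minus_ln_antimono[OF s(1)] s(2)
    by (intro eventually_mono[OF eventually_ge_at_top[of s]]) (auto intro: le_less_trans)
qed

text \<open>Tauberian step: as \<open>m\<close> is nonincreasing, \<open>(c - 1) * t * m t\<close>
  is at least \<open>M (c * t) - M t\<close>, which tends to \<open>ln c \<ge> 1 - 1 / c\<close>. So
  the lower limit of \<open>t * m t\<close> is at least \<open>1 / c\<close> for every
  \<open>c > 1\<close>.\<close>

lemma time_m_tendsto_1: "((\<lambda>t. t * m t) \<longlongrightarrow> 1) at_top"
proof (rule order_tendstoI)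
  fix a :: real assume "1 < a"
  then show "\<forall>\<^sub>F t in at_top. t * m t < a"
    using time_m_le_1 by (intro eventually_mono[OF eventually_ge_at_top[of 0]]) (auto intro: le_less_trans)
next
  fix a :: real assume "a < 1"
  define a' where "a' = max a (1 / 2)"
  have a': "a \<le> a'" "0 < a'" "a' < 1" using \<open>a < 1\<close> by (auto simp: a'_def)
  \<comment> \<open>\<open>1 / c\<close> is the midpoint of \<open>a'\<close> and 1. The tolerance
    \<open>(1 / c - a') * (c - 1)\<close> used below lowers \<open>1 - 1 / c\<close> to exactly
    \<open>(c - 1) * a'\<close>.\<close>
  define c where "c = 2 / (1 + a')"
  have c: "1 < c" "a' < 1 / c" using a' by (auto simp: c_def field_simps)
  let ?E = "\<lambda>t. M t - ln t"
  have "filterlim (\<lambda>t. c * t) at_top at_top"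
    using c by (intro filterlim_tendsto_pos_mult_at_top[OF tendsto_const _ filterlim_ident]) auto
  then have "((\<lambda>t. ?E (c * t)) \<longlongrightarrow> 1 + ln (b 0 1)) at_top"
    using M_minus_ln_tendsto by (rule filterlim_compose[rotated])
  from tendsto_diff[OF this M_minus_ln_tendsto]
  have "((\<lambda>t. ?E (c * t) - ?E t) \<longlongrightarrow> 0) at_top" by simp
  moreover have "- ((1 / c - a') * (c - 1)) < 0" using c by simp
  ultimately have "\<forall>\<^sub>F t in at_top. - ((1 / c - a') * (c - 1)) < ?E (c * t) - ?E t"
    by (rule order_tendstoD)
  then show "\<forall>\<^sub>F t in at_top. a < t * m t"
    using eventually_gt_at_top[of 0]
  proof eventually_elim
    case (elim t)
    have "M (c * t) - M t \<le> (c * t - t) * m t"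
      using elim c by (intro M_diff_le) auto
    moreover have "1 - 1 / c \<le> ln c"
      using ln_le_minus_one[of "1 / c"] c by (simp add: ln_div)
    moreover have "ln (c * t) = ln c + ln t" using c elim by (simp add: ln_mult_pos)
    ultimately have "(1 - 1 / c) - (1 / c - a') * (c - 1) < (c - 1) * (t * m t)"
      using elim by (simp add: algebra_simps)
    also have "(1 - 1 / c) - (1 / c - a') * (c - 1) = (c - 1) * a'"
      using c by (simp add: field_simps)
    finally show ?case using a' c by simp
  qed
qed

section \<open>Limits of the individual coefficients\<close>

text \<open>\<open>w 1\<close> is constant. For larger \<open>k\<close>, l'Hospital reduces the
  quotient to a convolution of earlier limits, which \<open>tree_coefficients_recursion\<close>
  evaluates.\<close>

lemma w_asymptotics:
  assumes "1 \<le> k"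
  shows "((\<lambda>t. w k t / t ^ (k - 1)) \<longlongrightarrow> b 0 1 ^ k * (real k ^ (k - 1) / fact k)) at_top"
  using assms
proof (induction k rule: less_induct)
  case (less k)
  define c where "c k = b 0 1 ^ k * (real k ^ (k - 1) / fact k)" for k
  define S where "S t = (\<Sum>l\<le>k. w l t * w (k - l) t)" for t
  have w_0: "w 0 t = 0" for t by (simp add: w_def)
  have deriv: "(w k has_real_derivative (real k / 2 * S t)) (at t)" if "0 < t" for t
    using w_has_derivative[of t "t + 1" k] at_within_Icc_at[of 0 t "t + 1"] that
    by (simp add: S_def)
  \<comment> \<open>The end terms contain \<open>w 0 t = 0\<close>, so only indices below
    \<open>k\<close> remain and the induction hypothesis applies.\<close>
  have S_eq: "S t = (\<Sum>l=1..k-1. w l t * w (k - l) t)" for t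
    unfolding S_def using less.prems
    by (intro sum.mono_neutral_right) (auto simp: w_0 not_le le_less_Suc_eq)
  show ?case
  proof (cases "k = 1")
    case True
    have "w 1 t = b 0 1" if "0 \<le> t" for t
    proof -
      have "w 1 t = w 1 0"
      proof (rule DERIV_isconst2[of 0 "t + 1"])
        show "continuous_on {0..t + 1} (w 1)"
          using w_has_derivative[of _ "t + 1" 1] by (rule DERIV_continuous_on)
        show "DERIV (w 1) x :> 0" if "0 < x" "x < t + 1" for x
          using deriv[of x] that True by (simp add: S_eq)
      qed (use that in auto)
      then show ?thesis by (simp add: w_def)
    qed
    then have "\<forall>\<^sub>F t in at_top. w k t / t ^ (k - 1) = b 0 1"
      using True by (intro eventually_mono[OF eventually_ge_at_top[of 0]]) auto
    then show ?thesis
      using True by (simp add: tendsto_eventually)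
  next
    case False
    then have k: "2 \<le> k" using less.prems by simp
    show ?thesis
    proof (rule lhospital_at_top_at_top)
      show "LIM t at_top. t ^ (k - 1) :> (at_top :: real filter)"
        using k by (intro filterlim_pow_at_top filterlim_ident) auto
      show "\<forall>\<^sub>F t in at_top. real (k - 1) * t ^ (k - 2) \<noteq> 0"
        using k by (intro eventually_mono[OF eventually_gt_at_top[of 0]]) auto
      show "\<forall>\<^sub>F t in at_top. (w k has_real_derivative real k / 2 * S t) (at t)"
        using deriv by (intro eventually_mono[OF eventually_gt_at_top[of 0]]) auto
      show "\<forall>\<^sub>F t in at_top. ((\<lambda>t. t ^ (k - 1)) has_real_derivative real (k - 1) * t ^ (k - 2)) (at t)"
        using k by (intro always_eventually allI)
          (auto intro!: derivative_eq_intros simp: diff_diff_eq numeral_2_eq_2)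
      have "((\<lambda>t. real k / 2 * (\<Sum>l=1..k-1. (w l t / t ^ (l - 1)) * (w (k - l) t / t ^ (k - l - 1))) / real (k - 1))
          \<longlongrightarrow> real k / 2 * (\<Sum>l=1..k-1. c l * c (k - l)) / real (k - 1)) at_top"
      proof (intro tendsto_intros)
        fix l assume l: "l \<in> {1..k-1}"
        show "((\<lambda>t. w l t / t ^ (l - 1)) \<longlongrightarrow> c l) at_top"
          unfolding c_def by (rule less.IH) (use l k in auto)
        show "((\<lambda>t. w (k - l) t / t ^ (k - l - 1)) \<longlongrightarrow> c (k - l)) at_top"
          unfolding c_def by (rule less.IH) (use l k in auto)
      qed (use k in auto)
      also have "real k / 2 * (\<Sum>l=1..k-1. c l * c (k - l)) / real (k - 1) = c k"
      proof -
        have "(\<Sum>l=1..k-1. c l * c (k - l)) = (\<Sum>l=1..k-1. b 0 1 ^ k *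
            ((real l ^ (l - 1) / fact l) * (real (k - l) ^ (k - l - 1) / fact (k - l))))"
        proof (rule sum.cong)
          fix l assume "l \<in> {1..k-1}"
          then have "k = l + (k - l)" by auto
          then have "b 0 1 ^ k = b 0 1 ^ l * b 0 1 ^ (k - l)" by (metis power_add)
          then show "c l * c (k - l) = b 0 1 ^ k *
            ((real l ^ (l - 1) / fact l) * (real (k - l) ^ (k - l - 1) / fact (k - l)))"
            by (simp add: c_def)
        qed simp
        also have "real k / 2 * \<dots> = b 0 1 ^ k * (real (k - 1) * (real k ^ (k - 1) / fact k))"
          unfolding sum_distrib_left[symmetric] tree_coefficients_recursion[OF k, symmetric] by simp
        finally show ?thesis using k by (simp add: c_def)
      qed
      finally have lim: "((\<lambda>t. real k / 2 * (\<Sum>l=1..k-1. (w l t / t ^ (l - 1)) * (w (k - l) t / t ^ (k - l - 1))) / real (k - 1))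
          \<longlongrightarrow> c k) at_top" .
      \<comment> \<open>The exponents \<open>l - 1\<close> and \<open>k - l - 1\<close> add up to
        \<open>k - 2\<close>, the power in the derivative of \<open>t ^ (k - 1)\<close>.\<close>
      have "\<forall>\<^sub>F t in at_top.
          real k / 2 * (\<Sum>l=1..k-1. (w l t / t ^ (l - 1)) * (w (k - l) t / t ^ (k - l - 1))) / real (k - 1)
          = (real k / 2 * S t) / (real (k - 1) * t ^ (k - 2))"
      proof (rule eventually_mono[OF eventually_gt_at_top[of 0]])
        fix t :: real assume "0 < t"
        have "(\<Sum>l=1..k-1. (w l t / t ^ (l - 1)) * (w (k - l) t / t ^ (k - l - 1))) = S t / t ^ (k - 2)"
          unfolding S_eq sum_divide_distrib
        proof (rule sum.cong)
          fix l assume "l \<in> {1..k-1}"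
          then have "k - 2 = (l - 1) + (k - l - 1)" by auto
          then have "t ^ (k - 2) = t ^ (l - 1) * t ^ (k - l - 1)" by (metis power_add)
          then show "(w l t / t ^ (l - 1)) * (w (k - l) t / t ^ (k - l - 1)) = w l t * w (k - l) t / t ^ (k - 2)"
            by simp
        qed simp
        then show "real k / 2 * (\<Sum>l=1..k-1. (w l t / t ^ (l - 1)) * (w (k - l) t / t ^ (k - l - 1))) / real (k - 1)
          = (real k / 2 * S t) / (real (k - 1) * t ^ (k - 2))" by simp
      qed
      with lim have "((\<lambda>t. (real k / 2 * S t) / (real (k - 1) * t ^ (k - 2))) \<longlongrightarrow> c k) at_top"
        by (rule Lim_transform_eventually)
      then show "((\<lambda>t. (real k / 2 * S t) / (real (k - 1) * t ^ (k - 2)))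
          \<longlongrightarrow> b 0 1 ^ k * (real k ^ (k - 1) / fact k)) at_top"
        by (simp only: c_def)
    qed
  qed
qed

text \<open>For \<open>t > 0\<close>,
  \<open>t * v t k = w k t / t ^ (k - 1) * (t * exp (- M t)) ^ k\<close>. Since
  \<open>t * exp (- M t)\<close> tends to \<open>exp (- 1) / b 0 1\<close>, the powers of
  \<open>b 0 1\<close> cancel.\<close>

lemma time_v_tendsto:
  assumes "1 \<le> k"
  shows "((\<lambda>t. t * v t k) \<longlongrightarrow> real k ^ (k - 1) / fact k * exp (- real k)) at_top"
proof -
  have "((\<lambda>t. exp (- (M t - ln t))) \<longlongrightarrow> exp (- (1 + ln (b 0 1)))) at_top"
    by (intro tendsto_intros M_minus_ln_tendsto)
  then have "((\<lambda>t. w k t / t ^ (k - 1) * exp (- (M t - ln t)) ^ k) \<longlongrightarrow>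
      b 0 1 ^ k * (real k ^ (k - 1) / fact k) * exp (- (1 + ln (b 0 1))) ^ k) at_top"
    by (intro tendsto_mult tendsto_power w_asymptotics assms)
  also have "b 0 1 ^ k * (real k ^ (k - 1) / fact k) * exp (- (1 + ln (b 0 1))) ^ k
      = real k ^ (k - 1) / fact k * exp (- real k)"
  proof -
    have "exp (- (1 + ln (b 0 1))) = exp (- 1) / b 0 1"
      using b_1_pos by (simp add: exp_diff exp_minus field_simps)
    moreover have "exp (- 1 :: real) ^ k = exp (- real k)"
      by (simp add: exp_of_nat_mult[symmetric])
    ultimately show ?thesis using b_1_pos by (simp add: power_divide)
  qed
  finally show ?thesis
  proof (rule Lim_transform_eventually)
    show "\<forall>\<^sub>F t in at_top. w k t / t ^ (k - 1) * exp (- (M t - ln t)) ^ k = t * v t k"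
    proof (rule eventually_mono[OF eventually_gt_at_top[of 0]])
      fix t :: real assume t: "0 < t"
      have "exp (- (M t - ln t)) = t / exp (M t)" using t by (simp add: exp_diff)
      moreover have "t ^ k = t * t ^ (k - 1)" using assms by (simp add: power_eq_if)
      ultimately show "w k t / t ^ (k - 1) * exp (- (M t - ln t)) ^ k = t * v t k"
        using t assms by (simp add: w_def b_def power_divide exp_of_nat_mult)
    qed
  qed
qed

end

theorem theorem7:
  fixes v :: "real \<Rightarrow> nat \<Rightarrow> real"
  assumes "in_N_star (v 0)"
    and "v 0 1 > 0"
    and "critical_solution v"
  shows "(\<forall>k\<ge>1. ((\<lambda>t. t * v t k) \<longlongrightarrow> real k ^ (k - 1) / fact k * exp (- real k)) at_top)
         \<and> ((\<lambda>t. t * mass0 (v t)) \<longlongrightarrow> 1) at_top"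
proof -
  interpret critical_positive v
    by unfold_locales (use assms in auto)
  show ?thesis
    using time_v_tendsto time_m_tendsto_1 by (simp add: m_def)
qed

end
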